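(* If $(f,g)$ is a binding pair, then $g(k)\ge k-1$ for all $k\in\mathbb{N}$.
   Context: Graphs are finite and simple. The cycle spectrum of a graph $G$ is $\Lambda(G)=\{\ell\in\mathbb{N}\mid G\text{ contains a cycle of length }\ell\}$. Let $f,g:\mathbb{N}\to\mathbb{R}$ be functions. The pair $(f,g)$ is a binding pair if for all $k\in\mathbb{N}$, every graph $G$ contains $k$ vertex-disjoint cycles of pairwise distinct lengths, or a set $X$ of at most $f(k)$ vertices such that $|\Lambda(G-X)|\le g(k)$. *)

theory Defs
  imports Complex_Main "Graph_Theory.Pair_Digraph" "Graph_Theory.Digraph_Component"
begin

(* A finite simple graph is a pair_graph: a finite, loop-free digraph with symmetric arc
   relation, so that an undirected edge is a pair of opposite arcs.  The walk u, v, u along one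
   edge is a cycle in the sense of pre_digraph.cycle; requiring length at least 3 leaves exactly
   the cycles of the undirected graph (each with a starting point and an orientation). *)
definition graph_cycle :: "('a, 'b) pre_digraph \<Rightarrow> 'b awalk \<Rightarrow> bool" where
  "graph_cycle G p \<longleftrightarrow> pre_digraph.cycle G p \<and> 3 \<le> length p"

(* On a closed walk every vertex is the tail of one of the arcs. *)
definition cycle_verts :: "('a, 'b) pre_digraph \<Rightarrow> 'b awalk \<Rightarrow> 'a set" where
  "cycle_verts G p = tail G ` set p"

definition cycle_spectrum :: "('a, 'b) pre_digraph \<Rightarrow> nat set" where
  "cycle_spectrum G = {l. \<exists>p. graph_cycle G p \<and> length p = l}"

definition delete_verts :: "('a, 'b) pre_digraph \<Rightarrow> 'a set \<Rightarrow> ('a, 'b) pre_digraph" where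
  "delete_verts G X = G \<restriction> (verts G - X)"

definition has_disjoint_cycles_distinct_lengths :: "('a, 'b) pre_digraph \<Rightarrow> nat \<Rightarrow> bool" where
  "has_disjoint_cycles_distinct_lengths G k \<longleftrightarrow>
     (\<exists>C :: nat \<Rightarrow> 'b awalk.
        (\<forall>i<k. graph_cycle G (C i)) \<and>
        (\<forall>i<k. \<forall>j<k. i \<noteq> j \<longrightarrow>
           cycle_verts G (C i) \<inter> cycle_verts G (C j) = {} \<and> length (C i) \<noteq> length (C j)))"

(* The index k ranges over the positive integers: every graph contains 0 cycles, so a condition
   at k = 0 would hold for arbitrary values f 0 and g 0.  Taking nat as the vertex type loses no
   generality, since every finite graph is isomorphic to one whose vertices are naturals. *)
definition binding_pair :: "(nat \<Rightarrow> real) \<Rightarrow> (nat \<Rightarrow> real) \<Rightarrow> bool" where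
  "binding_pair f g \<longleftrightarrow>
     (\<forall>k\<ge>1. \<forall>G :: nat pair_pre_digraph. pair_graph G \<longrightarrow>
        has_disjoint_cycles_distinct_lengths (with_proj G) k \<or>
        (\<exists>X \<subseteq> pverts G. real (card X) \<le> f k \<and>
           real (card (cycle_spectrum (delete_verts (with_proj G) X))) \<le> g k))"

end

(* For fixed k take N > f k disjoint copies of the complete graph on k + 1 vertices.  Every cycle
   stays inside one copy, so all cycle lengths lie in {3..k+1}, a set of only k - 1 elements, and
   there are no k cycles of distinct lengths.  Deleting at most f k vertices leaves some copy
   untouched, and that copy still realises every length in {3..k+1}. *)
theory Submission
  imports Defs
begin

text \<open>The \<open>N\<close> copies are consecutive blocks of \<open>m\<close> naturals, so that
  \<open>u div m\<close> is the index of the copy containing \<open>u\<close>.\<close>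

definition clique_union :: "nat \<Rightarrow> nat \<Rightarrow> nat pair_pre_digraph" where
  "clique_union N m = \<lparr> pverts = {..<N * m},
     parcs = {(u, v). u < N * m \<and> v < N * m \<and> u \<noteq> v \<and> u div m = v div m} \<rparr>"

lemma pair_graph_clique_union: "pair_graph (clique_union N m)"
proof -
  have "parcs (clique_union N m) \<subseteq> {..<N * m} \<times> {..<N * m}"
    by (auto simp: clique_union_def)
  then have "finite (parcs (clique_union N m))"
    by (rule finite_subset) simp
  then show ?thesis
    by unfold_locales (auto simp: clique_union_def symmetric_def sym_def)
qed

lemma (in pre_digraph) awalk_verts_constant:
  assumes "cas u p v" and "\<And>e. e \<in> set p \<Longrightarrow> \<phi> (tail G e) = \<phi> (head G e)"
    and "w \<in> set (awalk_verts u p)"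
  shows "\<phi> w = \<phi> u"
  using assms by (induction p arbitrary: u) auto

text \<open>A walk along such arcs never leaves the fibre of \<open>\<phi>\<close> in which it
  starts, and a cycle has as many distinct vertices as arcs.\<close>

lemma (in pre_digraph) cycle_length_le_card_fibre:
  assumes "cycle p"
    and "\<And>e. e \<in> arcs G \<Longrightarrow> \<phi> (tail G e) = \<phi> (head G e)"
    and "\<And>c. finite {w. \<phi> w = c}" and "\<And>c. card {w. \<phi> w = c} \<le> m"
  shows "length p \<le> m"
proof -
  obtain u where u: "awalk u p u" "distinct (tl (awalk_verts u p))"
    using assms(1) unfolding cycle_def by blast
  have "\<phi> w = \<phi> u" if "w \<in> set (awalk_verts u p)" for w
    using u(1) assms(2) that unfolding awalk_def by (blast intro: awalk_verts_constant)
  then have sub: "set (tl (awalk_verts u p)) \<subseteq> {w. \<phi> w = \<phi> u}"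
    by (auto dest: list.set_sel(2)[rotated])
  \<comment> \<open>Dropping the starting vertex, which recurs at the end, leaves one vertex per
    arc.\<close>
  have "length p = length (tl (awalk_verts u p))"
    by (simp add: length_awalk_verts)
  also have "\<dots> = card (set (tl (awalk_verts u p)))"
    using distinct_card[OF u(2)] by simp
  also have "\<dots> \<le> card {w. \<phi> w = \<phi> u}"
    using sub assms(3) by (rule card_mono[rotated])
  also have "\<dots> \<le> m" by (rule assms(4))
  finally show ?thesis .
qed

lemma div_fibre:
  assumes "0 < m" shows "{w::nat. w div m = c} = {c * m..<c * m + m}"
proof -
  have "w div m = c \<longleftrightarrow> w \<in> {c * m..<c * m + m}" for w
    using assms dividend_less_div_times[of m w] by (auto simp: div_nat_eqI mult.commute)
  then show ?thesis by blast
qed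

text \<open>Stated for arbitrary graphs so as to serve both the union of cliques and what remains
  after deletions. For \<open>m = 0\<close> all naturals would form a single infinite fibre.\<close>

lemma cycle_spectrum_subset_fibre:
  fixes G :: "(nat, 'b) pre_digraph"
  assumes "\<And>e. e \<in> arcs G \<Longrightarrow> tail G e div m = head G e div m" and "0 < m"
  shows "cycle_spectrum G \<subseteq> {3..m}"
proof -
  have "length p \<le> m" if "pre_digraph.cycle G p" for p
    using assms(2)
    by (intro pre_digraph.cycle_length_le_card_fibre[OF that assms(1)]) (simp_all add: div_fibre)
  then show ?thesis
    by (auto simp: cycle_spectrum_def graph_cycle_def)
qed

text \<open>Distinct lengths would inject \<open>{..<k}\<close> into the spectrum. Finiteness
  matters because \<open>card\<close> is 0 on infinite sets.\<close>

lemma no_disjoint_cycles_if_card_spectrum_less: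
  assumes "finite (cycle_spectrum G)" and "card (cycle_spectrum G) < k"
  shows "\<not> has_disjoint_cycles_distinct_lengths G k"
proof
  assume "has_disjoint_cycles_distinct_lengths G k"
  then obtain C where C: "\<forall>i<k. graph_cycle G (C i)"
    "\<forall>i<k. \<forall>j<k. i \<noteq> j \<longrightarrow> length (C i) \<noteq> length (C j)"
    unfolding has_disjoint_cycles_distinct_lengths_def by blast
  have "inj_on (\<lambda>i. length (C i)) {..<k}"
    using C(2) by (auto simp: inj_on_def)
  moreover have "(\<lambda>i. length (C i)) ` {..<k} \<subseteq> cycle_spectrum G"
    using C(1) by (auto simp: cycle_spectrum_def)
  ultimately have "card {..<k} \<le> card (cycle_spectrum G)"
    using assms(1) by (rule card_inj_on_le)
  then show False using assms(2) by simp
qed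

text \<open>Turns a list of vertices into a walk given by arcs; the choice \<open>v = hd xs\<close>
  closes it.\<close>

lemma cas_zip_tl:
  assumes "tail G = fst" and "head G = snd" and "xs \<noteq> []"
  shows "pre_digraph.cas G (hd xs) (zip xs (tl xs @ [v])) v"
  using assms(3)
proof (induction xs)
  case (Cons x xs)
  then show ?case
    by (cases xs) (auto simp: assms(1,2) pre_digraph.cas.simps)
qed simp

lemma length_in_cycle_spectrum_if_clique:
  fixes G :: "('a, 'a \<times> 'a) pre_digraph"
  assumes ends: "tail G = fst" "head G = snd"
    and xs: "distinct xs" "3 \<le> length xs" "set xs \<subseteq> verts G"
    and clique: "\<And>x y. x \<in> set xs \<Longrightarrow> y \<in> set xs \<Longrightarrow> x \<noteq> y \<Longrightarrow> (x, y) \<in> arcs G"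
  shows "length xs \<in> cycle_spectrum G"
proof -
  interpret pre_digraph G .
  \<comment> \<open>Each vertex is joined to its cyclic successor, so \<open>p\<close> traverses
    \<open>xs\<close> and returns to the start.\<close>
  define p where "p = zip xs (rotate1 xs)"
  have ne: "xs \<noteq> []" using xs(2) by auto
  have len: "length p = length xs" by (simp add: p_def)
  have "rotate1 xs = tl xs @ [hd xs]"
    using ne by (simp add: rotate1_hd_tl)
  then have cas: "cas (hd xs) p (hd xs)"
    unfolding p_def using cas_zip_tl[OF ends ne] by simp
  have arcs: "set p \<subseteq> arcs G"
  proof
    fix e assume "e \<in> set p"
    then obtain i where i: "i < length xs" "e = (xs ! i, xs ! (Suc i mod length xs))"
      by (auto simp: p_def in_set_zip nth_rotate1 prod_eq_iff)
    \<comment> \<open>With at least two vertices the cyclic successor is another position, so the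
      pair is not a loop.\<close>
    have "Suc i mod length xs \<noteq> i"
      using i(1) xs(2) by (cases "Suc i = length xs") auto
    moreover have "Suc i mod length xs < length xs"
      using xs(2) by (intro mod_less_divisor) linarith
    ultimately show "e \<in> arcs G"
      using i xs(1) clique by (simp add: nth_eq_iff_index_eq)
  qed
  have "p \<noteq> []" using len ne by auto
  moreover have "tl (awalk_verts (hd xs) p) = rotate1 xs"
    using awalk_verts_conv'[OF cas] \<open>p \<noteq> []\<close> by (simp add: ends p_def)
  moreover have "awalk (hd xs) p (hd xs)"
    using cas arcs xs(3) ne by (auto simp: awalk_def)
  ultimately have "cycle p"
    using xs(1) by (auto simp: cycle_def intro!: exI[of _ "hd xs"])
  then show ?thesis
    using len xs(2) by (auto simp: cycle_spectrum_def graph_cycle_def)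
qed

lemma cycle_spectrum_clique_union_delete:
  assumes "finite X" and "card X < N" and "0 < m"
  shows "cycle_spectrum (delete_verts (with_proj (clique_union N m)) X) = {3..m}"
    (is "cycle_spectrum ?H = _")
proof
  show "cycle_spectrum ?H \<subseteq> {3..m}"
    using assms(3)
    by (intro cycle_spectrum_subset_fibre) (auto simp: delete_verts_def clique_union_def)
  \<comment> \<open>Pigeonhole: fewer than \<open>N\<close> deleted vertices cannot meet all
    \<open>N\<close> copies.\<close>
  have "\<not> {..<N} \<subseteq> (\<lambda>x. x div m) ` X"
  proof
    assume "{..<N} \<subseteq> (\<lambda>x. x div m) ` X"
    then have "card {..<N} \<le> card X"
      by (rule surj_card_le[OF assms(1)])
    then show False using assms(2) by simp
  qed
  then obtain b where b: "b < N" "\<And>x. x \<in> X \<Longrightarrow> x div m \<noteq> b"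
    by auto
  have "(b + 1) * m \<le> N * m"
    using b(1) by (intro mult_le_mono1) simp
  then have copy: "x < N * m \<and> x \<notin> X \<and> x div m = b" if "x \<in> {b * m..<b * m + m}" for x
  proof -
    have "x div m = b"
      using that div_fibre[OF assms(3), of b] by blast
    with that b(2) \<open>(b + 1) * m \<le> N * m\<close> show ?thesis by auto
  qed
  show "{3..m} \<subseteq> cycle_spectrum ?H"
  proof
    fix l assume l: "l \<in> {3..m}"
    \<comment> \<open>The cycle runs through the first \<open>l\<close> vertices of the untouched
      copy \<open>b\<close>.\<close>
    have "length [b * m..<b * m + l] \<in> cycle_spectrum ?H"
      using l copy
      by (intro length_in_cycle_spectrum_if_clique)
        (auto simp: delete_verts_def clique_union_def)
    then show "l \<in> cycle_spectrum ?H" by simp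
  qed
qed

theorem theorem3p1:
  fixes f g :: "nat \<Rightarrow> real"
  assumes "binding_pair f g"
  shows "\<forall>k\<ge>1. g k \<ge> real k - 1"
proof (intro allI impI)
  fix k :: nat assume k: "1 \<le> k"
  \<comment> \<open>\<open>nat\<close> turns a negative ceiling into 0; in every case
    \<open>N\<close> exceeds \<open>f k\<close>.\<close>
  define N where "N = nat \<lceil>f k\<rceil> + 1"
  let ?G = "clique_union N (k + 1)"
  have "cycle_spectrum (with_proj ?G) \<subseteq> {3..k + 1}"
    by (intro cycle_spectrum_subset_fibre) (auto simp: clique_union_def)
  \<comment> \<open>For \<open>k = 1\<close> the interval \<open>{3..k + 1}\<close> is empty, so its
    size is \<open>k - 1\<close> there as well.\<close>
  then have "finite (cycle_spectrum (with_proj ?G))" "card (cycle_spectrum (with_proj ?G)) < k"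
    using k card_mono[of "{3..k + 1}" "cycle_spectrum (with_proj ?G)"]
    by (auto intro: finite_subset)
  then have "\<not> has_disjoint_cycles_distinct_lengths (with_proj ?G) k"
    by (rule no_disjoint_cycles_if_card_spectrum_less)
  then obtain X where X: "X \<subseteq> pverts ?G" "real (card X) \<le> f k"
    "real (card (cycle_spectrum (delete_verts (with_proj ?G) X))) \<le> g k"
    using assms k pair_graph_clique_union unfolding binding_pair_def by blast
  have "finite X"
    using X(1) by (rule finite_subset) (simp add: clique_union_def)
  moreover have "card X < N"
    using X(2) unfolding N_def by linarith
  ultimately have "cycle_spectrum (delete_verts (with_proj ?G) X) = {3..k + 1}"
    by (rule cycle_spectrum_clique_union_delete) simp
  then show "g k \<ge> real k - 1"
    using X(3) k by simp
qed

end
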